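(* Let $G = G_L \rtimes G_R$ be a semidirect product of two finite groups, i.e. $G$ is a finite group with operation $\cdot$, $G_L$ is a normal subgroup of $G$, $G_R$ is a subgroup of $G$, $G_L\cap G_R=\{1\}$ and $|G_L||G_R| = |G|$. Write each $x\in G$ uniquely as $x = x_L x_R^{-1}$ with $x_L\in G_L$, $x_R\in G_R$, and define a second operation $\circ$ on $G$ by \[ x\circ y = x_L x_R^{-1}\circ y_L y_R^{-1} = x_L y_L y_R^{-1} x_R^{-1} = x_L\, y\, x_R^{-1}. \] Then $(G,\circ,\cdot)$ is a bi-skew brace.
   Context: A bi-skew brace $(B,\circ,\star)$ is a finite set $B$ with two operations $\star$ and $\circ$ such that $(B,\star)$ is a group, $(B,\circ)$ is a group, and both compatibility conditions \[ a \circ (b \star c) = (a \circ b) \star a^{-1} \star (a \circ c), \qquad a \star (b \circ c) = (a \star b) \circ \overline{a} \circ (a \star c) \] hold for all $a,b,c\in B$, where $a^{-1}$ is the inverse of $a$ in $(B,\star)$ and $\overline{a}$ is the inverse of $a$ in $(B,\circ)$. In the claim, $\star$ is the given group operation $\cdot$ of $G$, which is denoted by juxtaposition. *)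

theory Defs
  imports "HOL-Algebra.Coset"
begin

text \<open>A bi-skew brace \<open>(B, \<circ>, \<star>)\<close> is given by two group structures \<open>C = (B, \<circ>)\<close> and
  \<open>S = (B, \<star>)\<close> with the same finite carrier.\<close>

locale bi_skew_brace = circ: group C + star: group S
  for C :: "('a, 'b) monoid_scheme" and S :: "('a, 'c) monoid_scheme" +
  assumes same_carrier: "carrier C = carrier S"
    and finite_carrier: "finite (carrier S)"
    and circ_compat: "\<lbrakk>a \<in> carrier S; b \<in> carrier S; c \<in> carrier S\<rbrakk> \<Longrightarrow>
      a \<otimes>\<^bsub>C\<^esub> (b \<otimes>\<^bsub>S\<^esub> c) =
        (a \<otimes>\<^bsub>C\<^esub> b) \<otimes>\<^bsub>S\<^esub> inv\<^bsub>S\<^esub> a \<otimes>\<^bsub>S\<^esub> (a \<otimes>\<^bsub>C\<^esub> c)"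
    and star_compat: "\<lbrakk>a \<in> carrier S; b \<in> carrier S; c \<in> carrier S\<rbrakk> \<Longrightarrow>
      a \<otimes>\<^bsub>S\<^esub> (b \<otimes>\<^bsub>C\<^esub> c) =
        (a \<otimes>\<^bsub>S\<^esub> b) \<otimes>\<^bsub>C\<^esub> inv\<^bsub>C\<^esub> a \<otimes>\<^bsub>C\<^esub> (a \<otimes>\<^bsub>S\<^esub> c)"

locale internal_semidirect_product = group G + normal L G + R: subgroup R G
  for G :: "('a, 'b) monoid_scheme" (structure) and L :: "'a set" and R :: "'a set" +
  assumes trivial_Int: "L \<inter> R = {\<one>}"
    and card_mult: "card L * card R = order G"

text \<open>Components \<open>x\<^sub>L\<close> and \<open>x\<^sub>R\<close> of \<open>x = x\<^sub>L x\<^sub>R\<^sup>-\<^sup>1\<close>. Note the inverse: \<open>x\<^sub>R\<close> is the inverse of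
  the right-hand factor of \<open>x\<close>.\<close>

definition left_part :: "('a, 'b) monoid_scheme \<Rightarrow> 'a set \<Rightarrow> 'a set \<Rightarrow> 'a \<Rightarrow> 'a" where
  "left_part G L R x = (THE l. l \<in> L \<and> (\<exists>r\<in>R. x = l \<otimes>\<^bsub>G\<^esub> inv\<^bsub>G\<^esub> r))"

definition right_part :: "('a, 'b) monoid_scheme \<Rightarrow> 'a set \<Rightarrow> 'a set \<Rightarrow> 'a \<Rightarrow> 'a" where
  "right_part G L R x = (THE r. r \<in> R \<and> (\<exists>l\<in>L. x = l \<otimes>\<^bsub>G\<^esub> inv\<^bsub>G\<^esub> r))"

definition circ_group :: "('a, 'b) monoid_scheme \<Rightarrow> 'a set \<Rightarrow> 'a set \<Rightarrow> 'a monoid" where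
  "circ_group G L R = \<lparr>carrier = carrier G,
     mult = (\<lambda>x y. left_part G L R x \<otimes>\<^bsub>G\<^esub> left_part G L R y \<otimes>\<^bsub>G\<^esub>
                    inv\<^bsub>G\<^esub> (right_part G L R y) \<otimes>\<^bsub>G\<^esub> inv\<^bsub>G\<^esub> (right_part G L R x)),
     one = \<one>\<^bsub>G\<^esub>\<rparr>"

context internal_semidirect_product
begin

lemma decomposition_unique:
  assumes "l \<in> L" "l' \<in> L" "r \<in> R" "r' \<in> R" and eq: "l \<otimes> inv r = l' \<otimes> inv r'"
  shows "l = l' \<and> r = r'"
proof -
  have c: "l \<in> carrier G" "l' \<in> carrier G" "r \<in> carrier G" "r' \<in> carrier G"
    using assms subset R.subset by auto
  have "inv l' \<otimes> l = inv l' \<otimes> (l \<otimes> inv r) \<otimes> r"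
    using c by (simp add: m_assoc)
  also have "\<dots> = inv r' \<otimes> r"
    unfolding eq using c by (simp add: m_assoc [symmetric])
  finally have e: "inv l' \<otimes> l = inv r' \<otimes> r" .
  moreover have "inv l' \<otimes> l \<in> L" "inv r' \<otimes> r \<in> R"
    using assms by auto
  ultimately have "inv l' \<otimes> l = \<one>" "inv r' \<otimes> r = \<one>"
    using trivial_Int by auto
  then show ?thesis
    using c inv_solve_left' [of \<one> l' l] inv_solve_left' [of \<one> r' r] by simp
qed

lemma decomposition_exists:
  assumes fin: "finite (carrier G)" and x: "x \<in> carrier G"
  shows "\<exists>l\<in>L. \<exists>r\<in>R. x = l \<otimes> inv r"
proof -
  let ?f = "\<lambda>(l, r). l \<otimes> inv r"
  have inj: "inj_on ?f (L \<times> R)"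
    by (auto simp: inj_on_def dest: decomposition_unique)
  have sub: "?f ` (L \<times> R) \<subseteq> carrier G"
    using subset R.subset by auto
  have "card (?f ` (L \<times> R)) = card (carrier G)"
    using card_mult by (simp add: card_image [OF inj] card_cartesian_product order_def)
  then have "?f ` (L \<times> R) = carrier G"
    using card_subset_eq [OF fin sub] by simp
  then have "x \<in> ?f ` (L \<times> R)"
    using x by simp
  then show ?thesis
    by auto
qed

lemma left_part_eq: "l \<in> L \<Longrightarrow> r \<in> R \<Longrightarrow> left_part G L R (l \<otimes> inv r) = l"
  unfolding left_part_def by (rule the_equality) (auto dest: decomposition_unique)

lemma right_part_eq: "l \<in> L \<Longrightarrow> r \<in> R \<Longrightarrow> right_part G L R (l \<otimes> inv r) = r"
  unfolding right_part_def by (rule the_equality) (auto dest: decomposition_unique)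

lemma
  assumes "finite (carrier G)" and "x \<in> carrier G"
  shows left_part_in: "left_part G L R x \<in> L"
    and right_part_in: "right_part G L R x \<in> R"
    and decomposition: "x = left_part G L R x \<otimes> inv (right_part G L R x)"
proof -
  obtain l r where "l \<in> L" "r \<in> R" "x = l \<otimes> inv r"
    using decomposition_exists [OF assms] by blast
  then show "left_part G L R x \<in> L" "right_part G L R x \<in> R"
    "x = left_part G L R x \<otimes> inv (right_part G L R x)"
    by (simp_all add: left_part_eq right_part_eq)
qed

lemma circ_mult_eq:
  assumes fin: "finite (carrier G)" and x: "x \<in> carrier G" and y: "y \<in> carrier G"
  shows "x \<otimes>\<^bsub>circ_group G L R\<^esub> y = left_part G L R x \<otimes> y \<otimes> inv (right_part G L R x)"
proof -
  have c: "left_part G L R z \<in> carrier G" "right_part G L R z \<in> carrier G"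
    if "z \<in> carrier G" for z
    using left_part_in [OF fin that] right_part_in [OF fin that] subset R.subset by auto
  have "x \<otimes>\<^bsub>circ_group G L R\<^esub> y =
      left_part G L R x \<otimes> (left_part G L R y \<otimes> inv (right_part G L R y)) \<otimes>
      inv (right_part G L R x)"
    using c [OF x] c [OF y] by (simp add: circ_group_def m_assoc)
  then show ?thesis
    by (simp flip: decomposition [OF fin y])
qed

end

end

(* If a = l r^-1 with l in L and r in R, then a \<circ> y = l y r^-1, so (G, \<circ>) is the direct
   product of L and R in disguise, with circle inverse l^-1 r of a. The first compatibility
   condition follows by cancellation. For the second, write b = m s^-1. Normality of L gives
   a b = (l (r^-1 m r)) (s r)^-1, hence (a b) \<circ> (l^-1 r) = (l r^-1 m r l^-1) s^-1 is again in
   decomposed form, and its circle product with a c collapses to a m c s^-1 = a (b \<circ> c). *)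

theory Submission
  imports Defs
begin

context internal_semidirect_product
begin

context
  assumes fin: "finite (carrier G)"
begin

abbreviation circ_mult (infixl "\<odot>" 70)
  where "x \<odot> y \<equiv> x \<otimes>\<^bsub>circ_group G L R\<^esub> y"

lemma L_carrier: "l \<in> L \<Longrightarrow> l \<in> carrier G"
  using subset by auto

lemma R_carrier: "r \<in> R \<Longrightarrow> r \<in> carrier G"
  using R.subset by auto

text \<open>This lemma and the next cancel an inverse pair at the head of a right-associated
  product, the normal form that \<open>m_assoc\<close> produces.\<close>

lemma inv_mult_cancel: "x \<in> carrier G \<Longrightarrow> y \<in> carrier G \<Longrightarrow> inv x \<otimes> (x \<otimes> y) = y"
  by (simp flip: m_assoc)

lemma mult_inv_cancel: "x \<in> carrier G \<Longrightarrow> y \<in> carrier G \<Longrightarrow> x \<otimes> (inv x \<otimes> y) = y"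
  by (simp flip: m_assoc)

text \<open>Uniqueness of the decomposition lets any given pair \<open>l\<close>, \<open>r\<close>
  replace the chosen parts, so later computations no longer meet \<open>left_part\<close> and
  \<open>right_part\<close>.\<close>

lemma circ_mult_decomposed:
  assumes "l \<in> L" "r \<in> R" "y \<in> carrier G"
  shows "(l \<otimes> inv r) \<odot> y = l \<otimes> y \<otimes> inv r"
  using assms
  by (simp add: circ_mult_eq [OF fin] left_part_eq right_part_eq L_carrier R_carrier)

text \<open>The result is again in decomposed form, with components \<open>l \<otimes> m\<close> and
  \<open>r \<otimes> s\<close>: the map sending \<open>(l, r)\<close> to
  \<open>l \<otimes> inv r\<close> carries the componentwise product on \<open>L \<times> R\<close>
  to \<open>\<odot>\<close>.\<close>

lemma circ_mult_decomposed2: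
  assumes "l \<in> L" "r \<in> R" "m \<in> L" "s \<in> R"
  shows "(l \<otimes> inv r) \<odot> (m \<otimes> inv s) = (l \<otimes> m) \<otimes> inv (r \<otimes> s)"
  using assms
  by (simp add: circ_mult_decomposed L_carrier R_carrier m_assoc inv_mult_group)

lemma decomposedE:
  assumes "x \<in> carrier G"
  obtains l r where "l \<in> L" "r \<in> R" "x = l \<otimes> inv r"
  using decomposition_exists [OF fin assms] by blast

lemma circ_one: "x \<in> carrier G \<Longrightarrow> \<one> \<odot> x = x"
  using circ_mult_decomposed [of \<one> \<one> x] by simp

text \<open>Inversion is componentwise; the double inverse displays \<open>inv r\<close> as the
  right component.\<close>

lemma circ_left_inverse:
  assumes "l \<in> L" "r \<in> R"
  shows "(inv l \<otimes> inv (inv r)) \<odot> (l \<otimes> inv r) = \<one>"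
  using assms circ_mult_decomposed2 [of "inv l" "inv r" l r]
  by (simp add: L_carrier R_carrier)

lemma group_circ: "group (circ_group G L R)"
proof (rule groupI)
  have carrier: "carrier (circ_group G L R) = carrier G"
    and one: "\<one>\<^bsub>circ_group G L R\<^esub> = \<one>"
    by (simp_all add: circ_group_def)
  show "\<one>\<^bsub>circ_group G L R\<^esub> \<in> carrier (circ_group G L R)"
    by (simp add: carrier one)
  fix x assume "x \<in> carrier (circ_group G L R)"
  then have x: "x \<in> carrier G"
    by (simp add: carrier)
  then obtain l r where lr: "l \<in> L" "r \<in> R" "x = l \<otimes> inv r"
    by (rule decomposedE)
  show "\<one>\<^bsub>circ_group G L R\<^esub> \<odot> x = x"
    using x by (simp add: one circ_one)
  show "\<exists>y\<in>carrier (circ_group G L R). y \<odot> x = \<one>\<^bsub>circ_group G L R\<^esub>"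
    using lr circ_left_inverse [OF lr(1,2)]
    by (intro bexI [of _ "inv l \<otimes> inv (inv r)"]) (simp_all add: carrier one L_carrier R_carrier)
  fix y assume "y \<in> carrier (circ_group G L R)"
  then have y: "y \<in> carrier G"
    by (simp add: carrier)
  then obtain m s where ms: "m \<in> L" "s \<in> R" "y = m \<otimes> inv s"
    by (rule decomposedE)
  show "x \<odot> y \<in> carrier (circ_group G L R)"
    using lr y by (simp add: carrier circ_mult_decomposed L_carrier R_carrier)
  fix z assume "z \<in> carrier (circ_group G L R)"
  then have z: "z \<in> carrier G"
    by (simp add: carrier)
  \<comment> \<open>Only the left factor of a circle product is split, so \<open>z\<close> stays
    whole.\<close>
  have "x \<odot> y \<odot> z = l \<otimes> m \<otimes> z \<otimes> inv (r \<otimes> s)"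
    unfolding lr(3) ms(3) circ_mult_decomposed2 [OF lr(1,2) ms(1,2)]
    using lr ms z by (simp add: circ_mult_decomposed)
  also have "\<dots> = x \<odot> (y \<odot> z)"
    using lr ms z
    by (simp add: circ_mult_decomposed L_carrier R_carrier m_assoc inv_mult_group)
  finally show "x \<odot> y \<odot> z = x \<odot> (y \<odot> z)" .
qed

lemma circ_inv:
  assumes "l \<in> L" "r \<in> R"
  shows "inv\<^bsub>circ_group G L R\<^esub> (l \<otimes> inv r) = inv l \<otimes> inv (inv r)"
  using group.inv_equality [OF group_circ, of "inv l \<otimes> inv (inv r)" "l \<otimes> inv r"]
    circ_left_inverse [OF assms] assms
  by (simp add: circ_group_def L_carrier R_carrier)

text \<open>With \<open>inv a = r \<otimes> inv l\<close>, the right side is l b r^-1 r l^-1 l c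
  r^-1, which cancels to l b c r^-1.\<close>

lemma circ_mult_mult:
  assumes "a \<in> carrier G" "b \<in> carrier G" "c \<in> carrier G"
  shows "a \<odot> (b \<otimes> c) = (a \<odot> b) \<otimes> inv a \<otimes> (a \<odot> c)"
proof -
  obtain l r where lr: "l \<in> L" "r \<in> R" "a = l \<otimes> inv r"
    using assms(1) by (rule decomposedE)
  then have "l \<in> carrier G" "r \<in> carrier G"
    by (simp_all add: L_carrier R_carrier)
  then show ?thesis
    using lr assms(2,3)
    by (simp add: circ_mult_decomposed m_assoc inv_mult_group inv_mult_cancel)
qed

lemma mult_circ_mult:
  assumes "a \<in> carrier G" "b \<in> carrier G" "c \<in> carrier G"
  shows "a \<otimes> (b \<odot> c) = (a \<otimes> b) \<odot> inv\<^bsub>circ_group G L R\<^esub> a \<odot> (a \<otimes> c)"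
proof -
  obtain l r where lr: "l \<in> L" "r \<in> R" "a = l \<otimes> inv r"
    using assms(1) by (rule decomposedE)
  obtain m s where ms: "m \<in> L" "s \<in> R" "b = m \<otimes> inv s"
    using assms(2) by (rule decomposedE)
  have car: "l \<in> carrier G" "r \<in> carrier G" "m \<in> carrier G" "s \<in> carrier G"
    using lr ms by (simp_all add: L_carrier R_carrier)
  \<comment> \<open>Chosen so that \<open>inv r \<otimes> m = n \<otimes> inv r\<close>: this moves
    the \<open>L\<close>-factor of \<open>b\<close> to the left past \<open>inv r\<close>.\<close>
  define n where "n = inv r \<otimes> m \<otimes> r"
  have n: "n \<in> L"
    unfolding n_def using inv_op_closed1 car(2) ms(1) .
  have nl: "l \<otimes> n \<otimes> inv l \<in> L"
    using inv_op_closed2 car(1) n .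
  have "a \<otimes> b = (l \<otimes> n) \<otimes> inv (s \<otimes> r)"
    using lr(3) ms(3) car by (simp add: n_def m_assoc inv_mult_group inv_mult_cancel mult_inv_cancel)
  then have "(a \<otimes> b) \<odot> inv\<^bsub>circ_group G L R\<^esub> a =
      (l \<otimes> n \<otimes> inv l) \<otimes> inv (s \<otimes> r \<otimes> inv r)"
    using lr ms n circ_mult_decomposed2 [of "l \<otimes> n" "s \<otimes> r" "inv l" "inv r"]
    by (simp add: circ_inv)
  \<comment> \<open>The right components \<open>r\<close> of \<open>a\<close> and
    \<open>inv r\<close> of its circle inverse cancel, leaving only \<open>s\<close>.\<close>
  then have "(a \<otimes> b) \<odot> inv\<^bsub>circ_group G L R\<^esub> a = (l \<otimes> n \<otimes> inv l) \<otimes> inv s"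
    using car by (simp add: m_assoc)
  then have "(a \<otimes> b) \<odot> inv\<^bsub>circ_group G L R\<^esub> a \<odot> (a \<otimes> c) =
      (l \<otimes> n \<otimes> inv l) \<otimes> (a \<otimes> c) \<otimes> inv s"
    using nl ms(2) assms by (simp add: circ_mult_decomposed)
  \<comment> \<open>After \<open>inv l\<close> cancels against the \<open>l\<close> in
    \<open>a\<close>, the relation n r^-1 = r^-1 m undoes the conjugation.\<close>
  also have "\<dots> = a \<otimes> (m \<otimes> c \<otimes> inv s)"
    using car assms(3) lr(3) by (simp add: n_def m_assoc inv_mult_cancel mult_inv_cancel)
  also have "\<dots> = a \<otimes> (b \<odot> c)"
    using ms assms(3) by (simp add: circ_mult_decomposed)
  finally show ?thesis by simp
qed

lemma bi_skew_brace_circ: "bi_skew_brace (circ_group G L R) G"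
proof (intro bi_skew_brace.intro bi_skew_brace_axioms.intro)
  show "group (circ_group G L R)" by (rule group_circ)
  show "group G" by (rule is_group)
  show "carrier (circ_group G L R) = carrier G" by (simp add: circ_group_def)
qed (fact fin circ_mult_mult mult_circ_mult)+

end

end

theorem proposition7p1:
  fixes G :: "('a, 'b) monoid_scheme" and L R :: "'a set"
  assumes "finite (carrier G)"
    and "internal_semidirect_product G L R"
  shows "bi_skew_brace (circ_group G L R) G"
  using internal_semidirect_product.bi_skew_brace_circ [OF assms(2,1)] .

end
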